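(* Let $G=(V,E)$ be a finite undirected unweighted graph and $\pi:V\to\{1,\dots,|V|\}$ a vertex order (a bijection). Then the total cost of all positive distance checks performed by BVC-PLL on $(G,\pi)$ is lower than or equal to the total cost of all positive distance checks performed by PLL on $(G,\pi)$.
   Context: A smaller value of $\pi$ means a higher rank. Labels $L(v)$ are finite sets of pairs (vertex, distance value); we write $u\in L(v)$ if some pair $(u,d)$ is in $L(v)$, and for $h\in L(v)$ the recorded value is written $d(h,v)=d(v,h)$. A minimum over the empty set is $+\infty$. Distance check. A distance check for $(u,d)$ at $v$ is the test $d<\min_{h\in L(u)\cap L(v)}\big(d(u,h)+d(h,v)\big)$ with the labels held at that moment. It is positive if the test is true (so $u$ is added to the label of $v$), otherwise negative. The cost of a distance check for $(u,d)$ at $v$ is $|L(v)|$, where $L(v)$ is the label of $v$ at the moment of the check. The total cost is the sum over all positive distance checks in the run. Algorithm PLL. Initially $L(v)=\emptyset$ for all $v$. For each $u\in V$ in order of increasing $\pi(u)$: let $Q$ be a FIFO queue containing $(u,0)$, with $u$ marked visited by $u$. While $Q$ is nonempty, pop $(v,d)$ and perform the distance check for $(u,d)$ at $v$ (this includes the initial entry, $v=u$, $d=0$). If it is positive, add $(u,d)$ to $L(v)$ and, for every neighbor $v'$ of $v$ that is not yet visited by $u$ and satisfies $\pi(u)<\pi(v')$, mark $v'$ visited by $u$ and add $(v',d+1)$ to $Q$. Algorithm BVC-PLL. Each vertex $v$ also holds a new label $\delta L(v)$ and a set $C(v)$ of flagged vertices. Initially $L(v)=C(v)=\emptyset$ for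 all $v$. Split $V$ into equal-size batches $B_1,\dots,B_T$ ($T$ divides $|V|$), where $B_i$ consists of the vertices $v$ with $(i-1)|V|/T+1\le\pi(v)\le i|V|/T$. For $i=1,\dots,T$ in order, do: - Set ActiveVertices $=B_i$; for every $u\in B_i$ set $\delta L(u)=\{(u,0)\}$ and $L(u)\leftarrow L(u)\cup\delta L(u)$ (no distance check is performed here). - While ActiveVertices $\ne\emptyset$, perform one iteration, starting with empty message sets. Scatter: for every active vertex $a$, every edge $(a,v)$ and every $(u,d)\in\delta L(a)$, if $\pi(u)<\pi(v)$ and $u\notin C(v)$, then add $u$ to $C(v)$ and send the message $(u,d+1)$ to $v$ (test and flagging are atomic); afterwards set ActiveVertices $=\emptyset$. Gather: for every vertex $v$ that received a message in this iteration: set $\delta L(v)=\emptyset$; for each message $(u,d)$ received by $v$, perform the distance check for $(u,d)$ at $v$ and, if it is positive, add $(u,d)$ to $\delta L(v)$; after all messages of $v$ are treated, if $\delta L(v)\neq\emptyset$, replace $L(v)$ by $L(v)\cup\delta L(v)$ and add $v$ to ActiveVertices. - Set $C(v)=\emptyset$ for all $v$. *)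

theory Defs
  imports "Graph_Theory.Pair_Digraph" "HOL-Library.Extended_Nat"
begin

section \<open>Loops\<close>

text \<open>
  Both algorithms leave some iteration orders open (the neighbours of a vertex, the messages sent
  in one iteration, and so on). Loop bodies are therefore relations between an initial and a
  final state, and \<open>for_set R X\<close> runs the body once for every element of \<open>X\<close>, in any order.
\<close>

inductive for_list :: "('x \<Rightarrow> 's \<Rightarrow> 's \<Rightarrow> bool) \<Rightarrow> 'x list \<Rightarrow> 's \<Rightarrow> 's \<Rightarrow> bool"
  for R where
  for_list_Nil: "for_list R [] s s"
| for_list_Cons: "R x s t \<Longrightarrow> for_list R xs t u \<Longrightarrow> for_list R (x # xs) s u"

definition for_set :: "('x \<Rightarrow> 's \<Rightarrow> 's \<Rightarrow> bool) \<Rightarrow> 'x set \<Rightarrow> 's \<Rightarrow> 's \<Rightarrow> bool" where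
  "for_set R X s t \<longleftrightarrow> (\<exists>xs. distinct xs \<and> set xs = X \<and> for_list R xs s t)"

inductive while_loop :: "('s \<Rightarrow> bool) \<Rightarrow> ('s \<Rightarrow> 's \<Rightarrow> bool) \<Rightarrow> 's \<Rightarrow> 's \<Rightarrow> bool"
  for b R where
  while_stop: "\<not> b s \<Longrightarrow> while_loop b R s s"
| while_step: "b s \<Longrightarrow> R s t \<Longrightarrow> while_loop b R t u \<Longrightarrow> while_loop b R s u"


section \<open>Distance checks\<close>

type_synonym 'a label = "('a \<times> nat) set"

text \<open>
  \<open>cost\<close> accumulates the costs of the positive distance checks performed so far.
\<close>

record 'a lstate =
  labels :: "'a \<Rightarrow> 'a label"
  cost :: nat

text \<open>The infimum of the empty set is \<open>\<infinity>\<close> in \<^typ>\<open>enat\<close>.\<close>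

definition positive_check :: "('a, 'z) lstate_scheme \<Rightarrow> 'a \<Rightarrow> nat \<Rightarrow> 'a \<Rightarrow> bool" where
  "positive_check s u d v \<longleftrightarrow>
     enat d < Inf {enat (d1 + d2) | h d1 d2. (h, d1) \<in> labels s u \<and> (h, d2) \<in> labels s v}"

definition count_check :: "'a \<Rightarrow> ('a, 'z) lstate_scheme \<Rightarrow> ('a, 'z) lstate_scheme" where
  "count_check v s = s\<lparr>cost := cost s + card (labels s v)\<rparr>"


section \<open>Algorithm PLL\<close>

text \<open>
  \<open>visited\<close> is the set of vertices marked as visited by the current source; marks of
  different sources do not interact.
\<close>

record 'a pll_state = "'a lstate" +
  queue :: "('a \<times> nat) list"
  visited :: "'a set"

definition pll_enqueue ::
    "('a \<Rightarrow> nat) \<Rightarrow> 'a \<Rightarrow> nat \<Rightarrow> 'a \<Rightarrow> 'a pll_state \<Rightarrow> 'a pll_state \<Rightarrow> bool" where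
  "pll_enqueue \<pi> u d w s t \<longleftrightarrow>
     t = (if w \<notin> visited s \<and> \<pi> u < \<pi> w
          then s\<lparr>visited := insert w (visited s), queue := queue s @ [(w, d + 1)]\<rparr>
          else s)"

definition pll_add :: "'a \<Rightarrow> nat \<Rightarrow> 'a \<Rightarrow> 'a pll_state \<Rightarrow> 'a pll_state" where
  "pll_add u d v s = s\<lparr>labels := (labels s)(v := insert (u, d) (labels s v))\<rparr>"

definition pll_pop ::
    "'a pair_pre_digraph \<Rightarrow> ('a \<Rightarrow> nat) \<Rightarrow> 'a \<Rightarrow> 'a pll_state \<Rightarrow> 'a pll_state \<Rightarrow> bool" where
  "pll_pop G \<pi> u s t \<longleftrightarrow>
     (\<exists>v d Q. queue s = (v, d) # Q \<and>
        (if positive_check s u d v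
         then for_set (pll_enqueue \<pi> u d) {w. (v, w) \<in> parcs G}
                (pll_add u d v (count_check v (s\<lparr>queue := Q\<rparr>))) t
         else t = s\<lparr>queue := Q\<rparr>))"

definition pll_source ::
    "'a pair_pre_digraph \<Rightarrow> ('a \<Rightarrow> nat) \<Rightarrow> 'a \<Rightarrow> 'a pll_state \<Rightarrow> 'a pll_state \<Rightarrow> bool" where
  "pll_source G \<pi> u s t \<longleftrightarrow>
     while_loop (\<lambda>s. queue s \<noteq> []) (pll_pop G \<pi> u) (s\<lparr>queue := [(u, 0)], visited := {u}\<rparr>) t"

definition pll_init :: "'a pll_state" where
  "pll_init = \<lparr>labels = (\<lambda>_. {}), cost = 0, queue = [], visited = {}\<rparr>"

text \<open>\<open>pll_run G \<pi> s\<close>: some complete run of PLL on \<open>(G, \<pi>)\<close> ends in state \<open>s\<close>.\<close>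

definition pll_run :: "'a pair_pre_digraph \<Rightarrow> ('a \<Rightarrow> nat) \<Rightarrow> 'a pll_state \<Rightarrow> bool" where
  "pll_run G \<pi> s \<longleftrightarrow>
     for_list (pll_source G \<pi>) (map (inv_into (pverts G) \<pi>) [1..<card (pverts G) + 1]) pll_init s"


section \<open>Algorithm BVC-PLL\<close>

record 'a bvc_state = "'a lstate" +
  delta :: "'a \<Rightarrow> 'a label"
  flags :: "'a \<Rightarrow> 'a set"
  active :: "'a set"
  msgs :: "'a \<Rightarrow> 'a label"

definition batch :: "'a pair_pre_digraph \<Rightarrow> ('a \<Rightarrow> nat) \<Rightarrow> nat \<Rightarrow> nat \<Rightarrow> 'a set" where
  "batch G \<pi> T i = {v \<in> pverts G.
     (i - 1) * card (pverts G) div T + 1 \<le> \<pi> v \<and> \<pi> v \<le> i * card (pverts G) div T}"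

definition bvc_start :: "'a set \<Rightarrow> 'a bvc_state \<Rightarrow> 'a bvc_state" where
  "bvc_start B s = s\<lparr>
     active := B,
     delta := (\<lambda>u. if u \<in> B then {(u, 0)} else delta s u),
     labels := (\<lambda>u. if u \<in> B then labels s u \<union> {(u, 0)} else labels s u)\<rparr>"

text \<open>
  One atomic test-and-flag step of the scatter phase. The steps for the triples of an active
  vertex, an edge at it and a pair in its new label are interleaved arbitrarily.
\<close>

definition bvc_send ::
    "('a \<Rightarrow> nat) \<Rightarrow> 'a \<times> 'a \<times> 'a \<times> nat \<Rightarrow> 'a bvc_state \<Rightarrow> 'a bvc_state \<Rightarrow> bool" where
  "bvc_send \<pi> = (\<lambda>(a, v, u, d) s t.
     t = (if \<pi> u < \<pi> v \<and> u \<notin> flags s v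
          then s\<lparr>flags := (flags s)(v := insert u (flags s v)),
                 msgs := (msgs s)(v := insert (u, d + 1) (msgs s v))\<rparr>
          else s))"

definition bvc_scatter ::
    "'a pair_pre_digraph \<Rightarrow> ('a \<Rightarrow> nat) \<Rightarrow> 'a bvc_state \<Rightarrow> 'a bvc_state \<Rightarrow> bool" where
  "bvc_scatter G \<pi> s t \<longleftrightarrow>
     (\<exists>r. for_set (bvc_send \<pi>)
            {(a, v, u, d). a \<in> active s \<and> (a, v) \<in> parcs G \<and> (u, d) \<in> delta s a} s r \<and>
          t = r\<lparr>active := {}\<rparr>)"

definition bvc_receive :: "'a \<Rightarrow> 'a \<times> nat \<Rightarrow> 'a bvc_state \<Rightarrow> 'a bvc_state \<Rightarrow> bool" where
  "bvc_receive v = (\<lambda>(u, d) s t.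
     t = (if positive_check s u d v
          then (count_check v s)\<lparr>delta := (delta s)(v := insert (u, d) (delta s v))\<rparr>
          else s))"

definition bvc_commit :: "'a \<Rightarrow> 'a bvc_state \<Rightarrow> 'a bvc_state" where
  "bvc_commit v s =
     (if delta s v \<noteq> {}
      then s\<lparr>labels := (labels s)(v := labels s v \<union> delta s v), active := insert v (active s)\<rparr>
      else s)"

definition bvc_gather_at :: "'a \<Rightarrow> 'a bvc_state \<Rightarrow> 'a bvc_state \<Rightarrow> bool" where
  "bvc_gather_at v s t \<longleftrightarrow>
     (\<exists>r. for_set (bvc_receive v) (msgs s v) (s\<lparr>delta := (delta s)(v := {})\<rparr>) r \<and>
          t = bvc_commit v r)"

definition bvc_gather :: "'a bvc_state \<Rightarrow> 'a bvc_state \<Rightarrow> bool" where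
  "bvc_gather s t \<longleftrightarrow> for_set bvc_gather_at {v. msgs s v \<noteq> {}} s t"

definition bvc_iteration ::
    "'a pair_pre_digraph \<Rightarrow> ('a \<Rightarrow> nat) \<Rightarrow> 'a bvc_state \<Rightarrow> 'a bvc_state \<Rightarrow> bool" where
  "bvc_iteration G \<pi> s t \<longleftrightarrow>
     (\<exists>r. bvc_scatter G \<pi> (s\<lparr>msgs := (\<lambda>_. {})\<rparr>) r \<and> bvc_gather r t)"

definition bvc_batch ::
    "'a pair_pre_digraph \<Rightarrow> ('a \<Rightarrow> nat) \<Rightarrow> nat \<Rightarrow> nat \<Rightarrow> 'a bvc_state \<Rightarrow> 'a bvc_state \<Rightarrow> bool" where
  "bvc_batch G \<pi> T i s t \<longleftrightarrow>
     (\<exists>r. while_loop (\<lambda>s. active s \<noteq> {}) (bvc_iteration G \<pi>) (bvc_start (batch G \<pi> T i) s) r \<and>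
          t = r\<lparr>flags := (\<lambda>_. {})\<rparr>)"

definition bvc_init :: "'a bvc_state" where
  "bvc_init = \<lparr>labels = (\<lambda>_. {}), cost = 0,
     delta = (\<lambda>_. {}), flags = (\<lambda>_. {}), active = {}, msgs = (\<lambda>_. {})\<rparr>"

text \<open>
  \<open>bvc_run G \<pi> T s\<close>: some complete run of BVC-PLL with \<open>T\<close> batches on \<open>(G, \<pi>)\<close> ends in state \<open>s\<close>.
\<close>

definition bvc_run ::
    "'a pair_pre_digraph \<Rightarrow> ('a \<Rightarrow> nat) \<Rightarrow> nat \<Rightarrow> 'a bvc_state \<Rightarrow> bool" where
  "bvc_run G \<pi> T s \<longleftrightarrow> for_list (bvc_batch G \<pi> T) [1..<T + 1] bvc_init s"


section \<open>Existence of complete runs\<close>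

text \<open>
  Runs are given by relations, so statements about all runs have content because both
  algorithms have complete runs on every finite graph.
\<close>

lemma for_list_total:
  assumes "\<And>x s. x \<in> set xs \<Longrightarrow> I s \<Longrightarrow> \<exists>t. R x s t \<and> I t" "I s"
  shows "\<exists>t. for_list R xs s t \<and> I t"
  using assms
proof (induction xs arbitrary: s)
  case Nil
  then show ?case using for_list_Nil[of R s] by auto
next
  case (Cons x xs)
  from Cons.prems(1)[of x s] Cons.prems(2) obtain t where t: "R x s t" "I t" by auto
  have "\<exists>u. for_list R xs t u \<and> I u"
    by (rule Cons.IH) (use Cons.prems(1) t(2) in auto)
  then obtain u where "for_list R xs t u" "I u" by auto
  with t(1) show ?case using for_list_Cons[of R x s t xs u] by auto
qed

lemma for_set_total:
  assumes "finite X" "\<And>x s. x \<in> X \<Longrightarrow> I s \<Longrightarrow> \<exists>t. R x s t \<and> I t" "I s"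
  shows "\<exists>t. for_set R X s t \<and> I t"
proof -
  obtain xs where "distinct xs" "set xs = X" using finite_distinct_list[OF assms(1)] by auto
  then show ?thesis using for_list_total[of xs I R s] assms unfolding for_set_def by metis
qed

lemma while_loop_total:
  fixes m :: "'s \<Rightarrow> nat"
  assumes "\<And>s. I s \<Longrightarrow> b s \<Longrightarrow> \<exists>t. R s t \<and> I t \<and> m t < m s" "I s"
  shows "\<exists>t. while_loop b R s t \<and> I t"
  using assms(2)
proof (induction "m s" arbitrary: s rule: less_induct)
  case less
  show ?case
  proof (cases "b s")
    case True
    then obtain t where t: "R s t" "I t" "m t < m s" using assms(1) less by blast
    then obtain u where "while_loop b R t u" "I u" using less by blast
    then show ?thesis using t True while_step by metis
  qed (use less while_stop in metis)
qed

lemma pll_run_exists: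
  fixes G :: "'a pair_pre_digraph"
  assumes "pair_pseudo_graph G"
  shows "\<exists>s. pll_run G \<pi> s"
proof -
  interpret pair_pseudo_graph G by fact
  let ?m = "\<lambda>s::'a pll_state. 2 * card (pverts G - visited s) + length (queue s)"
  have fin: "finite {w. (v, w) \<in> parcs G}" for v
    by (rule finite_subset[OF _ pair_finite_verts]) (auto dest: in_arcsD2)
  have pop: "\<exists>t. pll_pop G \<pi> u s t \<and> True \<and> ?m t < ?m s" if ne: "queue s \<noteq> []" for u s
  proof -
    obtain v d Q where q: "queue s = (v, d) # Q" using ne by (cases "queue s") auto
    have enq: "\<exists>t. pll_enqueue \<pi> u d w r t \<and> ?m t < ?m s"
      if "w \<in> {w. (v, w) \<in> parcs G}" "?m r < ?m s" for w r
    proof -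
      have "w \<in> pverts G" using that(1) in_arcsD2[of v w] by simp
      moreover have "w \<notin> visited r \<Longrightarrow> w \<in> pverts G \<Longrightarrow>
          card (pverts G - visited r) = Suc (card (pverts G - insert w (visited r)))"
        using card_Suc_Diff1[of "pverts G - visited r" w] pair_finite_verts
        unfolding Diff_insert[of "pverts G" w "visited r"] by simp
      ultimately show ?thesis using that(2) unfolding pll_enqueue_def by (cases "w \<in> visited r") auto
    qed
    let ?r = "pll_add u d v (count_check v (s\<lparr>queue := Q\<rparr>))"
    have "?m ?r < ?m s" by (simp add: pll_add_def count_check_def q)
    then have "\<exists>t. for_set (pll_enqueue \<pi> u d) {w. (v, w) \<in> parcs G} ?r t \<and> ?m t < ?m s"
      using fin enq by (intro for_set_total)
    then show ?thesis unfolding pll_pop_def using q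
      by (cases "positive_check s u d v") auto
  qed
  have "\<exists>t. pll_source G \<pi> u s t \<and> True" for u s
    unfolding pll_source_def
    by (rule while_loop_total[of "\<lambda>_. True" _ _ ?m]) (use pop in auto)
  then have "\<exists>s. for_list (pll_source G \<pi>) (map (inv_into (pverts G) \<pi>) [1..<card (pverts G) + 1])
      pll_init s \<and> True"
    by (intro for_list_total) auto
  then show ?thesis unfolding pll_run_def by blast
qed

lemma bvc_run_exists:
  fixes G :: "'a pair_pre_digraph"
  assumes "pair_pseudo_graph G"
  shows "\<exists>s. bvc_run G \<pi> T s"
proof -
  interpret pair_pseudo_graph G by fact
  let ?V = "pverts G"
  define wf where "wf s \<longleftrightarrow> active s \<subseteq> ?V \<and> (\<forall>v. finite (delta s v) \<and> (\<forall>p\<in>delta s v. fst p \<in> ?V))"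
    for s :: "'a bvc_state"
  define wfm where "wfm s \<longleftrightarrow> (\<forall>v. finite (msgs s v) \<and> (\<forall>p\<in>msgs s v. fst p \<in> ?V) \<and> (msgs s v \<noteq> {} \<longrightarrow> v \<in> ?V))"
    for s :: "'a bvc_state"
  define c where "c f = card {(u, v). u \<in> ?V \<and> v \<in> ?V \<and> u \<notin> f v}" for f :: "'a \<Rightarrow> 'a set"
  let ?m = "\<lambda>s::'a bvc_state. 2 * c (flags s) + (if active s = {} then 0 else 1)"
  have cdec: "c (f(v := insert u (f v))) < c f" if "u \<in> ?V" "v \<in> ?V" "u \<notin> f v" for u v f
    unfolding c_def
  proof (rule psubset_card_mono)
    show "finite {(u, v). u \<in> ?V \<and> v \<in> ?V \<and> u \<notin> f v}"
      by (rule finite_subset[of _ "?V \<times> ?V"]) (auto simp: pair_finite_verts)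
    show "{(u', v'). u' \<in> ?V \<and> v' \<in> ?V \<and> u' \<notin> (f(v := insert u (f v))) v'} \<subset>
       {(u, v). u \<in> ?V \<and> v \<in> ?V \<and> u \<notin> f v}"
      using that by (auto split: if_splits)
  qed
  have it: "\<exists>t. bvc_iteration G \<pi> s t \<and> wf t \<and> ?m t < ?m s" if "wf s" "active s \<noteq> {}" for s
  proof -
    let ?s = "s\<lparr>msgs := (\<lambda>_. {})\<rparr>"
    let ?X = "{(a, v, u, d). a \<in> active ?s \<and> (a, v) \<in> parcs G \<and> (u, d) \<in> delta ?s a}"
    let ?I = "\<lambda>r. wf r \<and> wfm r \<and> c (flags r) \<le> c (flags s) \<and>
      ((\<exists>v. msgs r v \<noteq> {}) \<longrightarrow> c (flags r) < c (flags s))"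
    have finX: "finite ?X"
      by (rule finite_subset[of _ "\<Union>a\<in>?V. {a} \<times> ?V \<times> delta s a"])
         (use that in \<open>auto simp: wf_def pair_finite_verts dest: in_arcsD2\<close>)
    have send: "\<exists>t. bvc_send \<pi> x r t \<and> ?I t" if x: "x \<in> ?X" and r: "?I r" for x r
    proof -
      obtain a v u d where xe: "x = (a, v, u, d)" by (metis surj_pair)
      have uv: "u \<in> ?V" "v \<in> ?V" using x xe \<open>wf s\<close> in_arcsD2[of a v] by (force simp: wf_def, simp)
      show ?thesis using r uv cdec[OF uv, of "flags r"]
        by (auto simp: xe bvc_send_def wf_def wfm_def)
    qed
    have "?I ?s" using \<open>wf s\<close> by (auto simp: wf_def wfm_def)
    from for_set_total[of _ ?I "bvc_send \<pi>", OF finX send this]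
    obtain r where r: "for_set (bvc_send \<pi>) ?X ?s r" "?I r" by blast
    let ?r = "r\<lparr>active := {}\<rparr>"
    have sc: "bvc_scatter G \<pi> ?s ?r" unfolding bvc_scatter_def using r by blast
    let ?J = "\<lambda>t. wf t \<and> flags t = flags r \<and> msgs t = msgs r \<and> ((\<forall>v. msgs r v = {}) \<longrightarrow> active t = {})"
    have at: "\<exists>t'. bvc_gather_at v t t' \<and> ?J t'" if v: "v \<in> {v. msgs ?r v \<noteq> {}}" and t: "?J t" for v t
    proof -
      have rec: "\<exists>t'. bvc_receive v x t t' \<and> ?J t'" if x: "x \<in> msgs r v" and t: "?J t" for x t
      proof -
        have "fst x \<in> ?V" using x r by (auto simp: wfm_def)
        then show ?thesis using t by (cases x) (simp add: bvc_receive_def wf_def count_check_def)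
      qed
      have fm: "finite (msgs r v)" using r by (auto simp: wfm_def)
      have "?J (t\<lparr>delta := (delta t)(v := {})\<rparr>)" using t by (auto simp: wf_def)
      from for_set_total[of _ ?J "bvc_receive v", OF fm rec this]
      obtain q where q: "for_set (bvc_receive v) (msgs r v) (t\<lparr>delta := (delta t)(v := {})\<rparr>) q" "?J q"
        by blast
      have "v \<in> ?V" "msgs r v \<noteq> {}" using v r by (auto simp: wfm_def)
      then have "?J (bvc_commit v q)" using q(2) by (auto simp: bvc_commit_def wf_def)
      moreover have "msgs t v = msgs r v" using t by simp
      ultimately show ?thesis unfolding bvc_gather_at_def using q(1) by auto
    qed
    have finv: "finite {v. msgs ?r v \<noteq> {}}"
      by (rule finite_subset[OF _ pair_finite_verts]) (use r in \<open>auto simp: wfm_def\<close>)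
    have "?J ?r" using r by (auto simp: wf_def)
    from for_set_total[of _ ?J bvc_gather_at, OF finv at this]
    obtain t where t: "bvc_gather ?r t" "?J t" unfolding bvc_gather_def by blast
    have "bvc_iteration G \<pi> s t" unfolding bvc_iteration_def using sc t(1) by blast
    moreover have "?m t < ?m s"
      using r(2) t(2) \<open>active s \<noteq> {}\<close> by (cases "\<forall>v. msgs r v = {}") auto
    ultimately show ?thesis using t(2) by blast
  qed
  have "\<exists>t. bvc_batch G \<pi> T i s t \<and> wf t" if "wf s" for i s
  proof -
    have "wf (bvc_start (batch G \<pi> T i) s)"
      using that by (auto simp: wf_def bvc_start_def batch_def)
    from while_loop_total[of wf "\<lambda>s. active s \<noteq> {}" "bvc_iteration G \<pi>" ?m, OF it this]
    obtain r where "while_loop (\<lambda>s. active s \<noteq> {}) (bvc_iteration G \<pi>) (bvc_start (batch G \<pi> T i) s) r"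
      "wf r" by blast
    moreover from this have "wf (r\<lparr>flags := (\<lambda>_. {})\<rparr>)" by (simp add: wf_def)
    ultimately show ?thesis unfolding bvc_batch_def by blast
  qed
  moreover have "wf bvc_init" by (auto simp: wf_def bvc_init_def)
  ultimately have "\<exists>s. for_list (bvc_batch G \<pi> T) [1..<T + 1] bvc_init s \<and> wf s"
    by (intro for_list_total)
  then show ?thesis unfolding bvc_run_def by blast
qed

end

theory Submission
  imports Defs
begin

text \<open>
  Call \<open>u\<close> a hub of \<open>v\<close> if it has the highest rank among all vertices on shortest paths between
  \<open>u\<close> and \<open>v\<close>. The pairs (hub, distance) form the canonical label of \<open>v\<close>. A search from \<open>u\<close> that is
  pruned by distance checks still reaches all \<open>v\<close> of which \<open>u\<close> is a hub, because \<open>u\<close> is then a hub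
  of all vertices on the shortest paths to \<open>v\<close>; hence PLL labels contain the canonical ones. In
  BVC-PLL a candidate \<open>(u, k + 1)\<close> at \<open>v\<close> that is not canonical is refuted by the vertex \<open>h\<close> of highest
  rank on the shortest paths, since \<open>h\<close> is a hub of both \<open>u\<close> and \<open>v\<close> at distance at most \<open>k\<close>, so that
  both entries are present already; hence BVC-PLL labels are exactly canonical. A check
  costs the number of entries before the new one, so PLL pays at least \<open>0 + 1 + \<dots> + (|L(v)| - 1)\<close> at
  \<open>v\<close>, while BVC-PLL pays at most that sum, as entries found in the same iteration do not count for
  each other.
\<close>

section \<open>Loops\<close>

text \<open>The invariant is indexed by the set of elements already treated, so that one statement
  covers every order that \<open>for_set\<close> may choose.\<close>

lemma for_list_invariant:
  assumes "for_list R xs s t" "distinct xs" "I {} s"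
    and step: "\<And>x Y s t. x \<in> set xs \<Longrightarrow> Y \<subseteq> set xs \<Longrightarrow> x \<notin> Y \<Longrightarrow> I Y s \<Longrightarrow> R x s t \<Longrightarrow> I (insert x Y) t"
  shows "I (set xs) t"
proof -
  have "I (Y \<union> set ys) t"
    if "for_list R ys s t" "distinct ys" "set ys \<inter> Y = {}" "set ys \<union> Y \<subseteq> set xs" "I Y s" for ys Y s
    using that
  proof (induction arbitrary: Y rule: for_list.induct)
    case (for_list_Cons x s t ys u)
    have "I (insert x Y) t" using for_list_Cons.prems for_list_Cons.hyps step by auto
    then have "I (insert x Y \<union> set ys) u"
      using for_list_Cons.prems by (intro for_list_Cons.IH) auto
    then show ?case by simp
  qed simp
  from this[of xs s "{}"] assms show ?thesis by simp
qed

lemma for_set_invariant: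
  assumes "for_set R X s t" "I {} s"
    and "\<And>x Y s t. x \<in> X \<Longrightarrow> Y \<subseteq> X \<Longrightarrow> x \<notin> Y \<Longrightarrow> I Y s \<Longrightarrow> R x s t \<Longrightarrow> I (insert x Y) t"
  shows "I X t"
  using assms for_list_invariant[of R _ s t I] unfolding for_set_def by blast

lemma for_list_upt_invariant:
  assumes "for_list R (map f [m..<n]) s t" "m \<le> n" "I m s"
    and "\<And>i s t. m \<le> i \<Longrightarrow> i < n \<Longrightarrow> I i s \<Longrightarrow> R (f i) s t \<Longrightarrow> I (Suc i) t"
  shows "I n t"
  using assms
proof (induction "n - m" arbitrary: m s)
  case 0
  then show ?case by (auto elim: for_list.cases)
next
  case (Suc k)
  then have "[m..<n] = m # [Suc m..<n]" by (simp add: upt_conv_Cons)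
  with Suc.prems(1) obtain r where r: "R (f m) s r" "for_list R (map f [Suc m..<n]) r t"
    by (auto elim: for_list.cases)
  show ?case
    by (rule Suc.hyps(1)[OF _ r(2)]) (use Suc.hyps(2) Suc.prems r in auto)
qed

lemma while_loop_invariant:
  assumes "while_loop b R s t" "I s" "\<And>s t. b s \<Longrightarrow> I s \<Longrightarrow> R s t \<Longrightarrow> I t"
  shows "I t \<and> \<not> b t"
  using assms by (induction rule: while_loop.induct) auto


section \<open>Hubs\<close>

text \<open>A strict bound below an infimum can be tested on the elements because
  \<open>enat d < x\<close> is the weak bound \<open>enat (Suc d) \<le> x\<close>.\<close>

lemma positive_check_iff:
  "positive_check s u d v \<longleftrightarrow>
     (\<forall>h d1 d2. (h, d1) \<in> labels s u \<longrightarrow> (h, d2) \<in> labels s v \<longrightarrow> d < d1 + d2)"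
  unfolding positive_check_def Suc_ile_eq[symmetric] le_Inf_iff by (force simp flip: enat_ord_simps(1) Suc_le_eq)

text \<open>The saving of BVC-PLL at one vertex: \<open>p\<close> entries that each pay for the
  \<open>l\<close> old ones cost at most what they cost when inserted one after another.\<close>

lemma sum_lessThan_add_ge: "(\<Sum>i<l. i) + p * l \<le> (\<Sum>i<l + p. i)" for l p :: nat
  by (induction p) auto

text \<open>The cost of filling finite labels one entry at a time from empty: an entry pays for
  those already present, hence 0 for the first.\<close>

definition ordered_pairs :: "'a set \<Rightarrow> ('a \<Rightarrow> 'a label) \<Rightarrow> nat" where
  "ordered_pairs V L = (\<Sum>v\<in>V. \<Sum>i<card (L v). i)"

lemma ordered_pairs_mono:
  assumes "\<And>v. v \<in> V \<Longrightarrow> L v \<subseteq> L' v" "\<And>v. v \<in> V \<Longrightarrow> finite (L' v)"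
  shows "ordered_pairs V L \<le> ordered_pairs V L'"
  unfolding ordered_pairs_def
proof (intro sum_mono sum_mono2)
  fix v assume "v \<in> V"
  then show "{..<card (L v)} \<subseteq> {..<card (L' v)}" using assms by (simp add: card_mono)
qed auto

lemma ordered_pairs_upd:
  assumes "finite V" "v \<in> V"
  shows "ordered_pairs V (L(v := l)) + (\<Sum>i<card (L v). i) = ordered_pairs V L + (\<Sum>i<card l. i)"
proof -
  have "(\<Sum>w\<in>V - {v}. \<Sum>i<card ((L(v := l)) w). i) = (\<Sum>w\<in>V - {v}. \<Sum>i<card (L w). i)"
    by (rule sum.cong) auto
  with assms show ?thesis unfolding ordered_pairs_def by (simp add: sum.remove[of V v])
qed

section \<open>Walks, hubs and common hubs on shortest paths\<close>

locale ranked_graph =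
  fixes V :: "'a set" and E :: "('a \<times> 'a) set" and \<pi> :: "'a \<Rightarrow> nat"
  assumes finite_V: "finite V" and E_subset: "E \<subseteq> V \<times> V" and sym_E: "sym E" and inj_\<pi>: "inj_on \<pi> V"
begin

text \<open>For walks of length \<open>i + j < n\<close> the conclusion fails, so \<open>n\<close> is the distance.\<close>

definition hub :: "'a \<Rightarrow> nat \<Rightarrow> 'a \<Rightarrow> bool" where
  "hub u n v \<longleftrightarrow> u \<in> V \<and> (u, v) \<in> E ^^ n \<and>
     (\<forall>x i j. (u, x) \<in> E ^^ i \<longrightarrow> (x, v) \<in> E ^^ j \<longrightarrow> i + j \<le> n \<longrightarrow> i + j = n \<and> \<pi> u \<le> \<pi> x)"

lemma relpow_sym: "(x, y) \<in> E ^^ n \<Longrightarrow> (y, x) \<in> E ^^ n"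
proof (induction n arbitrary: y)
  case (Suc n)
  then obtain z where "(x, z) \<in> E ^^ n" "(z, y) \<in> E" by auto
  then show ?case using Suc.IH sym_E by (blast dest: symD intro: relpow_Suc_I2)
qed simp

lemma relpow_trans: "(x, y) \<in> E ^^ i \<Longrightarrow> (y, z) \<in> E ^^ j \<Longrightarrow> (x, z) \<in> E ^^ (i + j)"
  by (auto simp: relpow_add)

lemma relpow_in_V: "(u, v) \<in> E ^^ n \<Longrightarrow> u \<in> V \<Longrightarrow> v \<in> V"
  using E_subset by (cases n) auto

lemma hub_walk: "hub u n v \<Longrightarrow> (u, v) \<in> E ^^ n"
  unfolding hub_def by blast

lemma hub_in_V: "hub u n v \<Longrightarrow> u \<in> V" "hub u n v \<Longrightarrow> v \<in> V"
  unfolding hub_def using relpow_in_V by blast+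

lemma hub_via: "hub u n v \<Longrightarrow> (u, x) \<in> E ^^ i \<Longrightarrow> (x, v) \<in> E ^^ j \<Longrightarrow> i + j \<le> n \<Longrightarrow> i + j = n \<and> \<pi> u \<le> \<pi> x"
  unfolding hub_def by blast

lemma hub_dist_le: "hub u n v \<Longrightarrow> (u, v) \<in> E ^^ m \<Longrightarrow> n \<le> m"
  using hub_via[of u n v v m 0] by fastforce

lemma hub_unique: "hub u n v \<Longrightarrow> hub u m v \<Longrightarrow> n = m"
  by (simp add: hub_dist_le hub_walk le_antisym)

lemma hub_0: "hub u 0 v \<longleftrightarrow> u \<in> V \<and> u = v"
  unfolding hub_def by auto

lemma hub_rank: "hub u n v \<Longrightarrow> \<pi> u \<le> \<pi> v"
  using hub_via[of u n v v n 0] hub_walk by auto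

lemma rank_eqD: "\<pi> u = \<pi> v \<Longrightarrow> u \<in> V \<Longrightarrow> v \<in> V \<Longrightarrow> u = v"
  using inj_\<pi> by (auto dest: inj_onD)

lemma hub_rank_less: "hub u n v \<Longrightarrow> u \<noteq> v \<Longrightarrow> \<pi> u < \<pi> v"
  using hub_rank hub_in_V rank_eqD by (metis le_neq_implies_less)

lemma hub_self: "hub u n u \<Longrightarrow> n = 0"
  using hub_dist_le[of u n u 0] by simp

text \<open>A walk from \<open>u\<close> to \<open>p\<close> of length at most \<open>n\<close>
  extends over the edge \<open>(p, v)\<close> to one that the hub condition at \<open>v\<close>
  controls. Searches can therefore be followed by induction on the distance.\<close>

lemma hub_pred:
  assumes "hub u (Suc n) v"
  obtains p where "hub u n p" "(p, v) \<in> E"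
proof -
  obtain p where p: "(u, p) \<in> E ^^ n" "(p, v) \<in> E" using hub_walk[OF assms] by auto
  have "i + j = n \<and> \<pi> u \<le> \<pi> x" if "(u, x) \<in> E ^^ i" "(x, p) \<in> E ^^ j" "i + j \<le> n" for x i j
    using hub_via[OF assms that(1), of "Suc j"] that p(2) by auto
  then show thesis using that p hub_in_V(1)[OF assms] unfolding hub_def by blast
qed

text \<open>The vertex of highest rank on the shortest paths between \<open>u\<close> and
  \<open>v\<close> is a hub of both ends: any vertex on a shortest path from it to one end also lies
  on a shortest path between \<open>u\<close> and \<open>v\<close>.\<close>

lemma common_hub:
  assumes "(u, v) \<in> E ^^ n" "u \<in> V"
  obtains h i j where "hub h i u" "hub h j v" "i + j \<le> n"
proof -
  define m where "m = (LEAST m. (u, v) \<in> E ^^ m)"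
  have m: "(u, v) \<in> E ^^ m" unfolding m_def using assms(1) by (rule LeastI)
  have least: "m \<le> l" if "(u, v) \<in> E ^^ l" for l unfolding m_def using that by (rule Least_le)
  let ?P = "\<lambda>x. \<exists>i j. (u, x) \<in> E ^^ i \<and> (x, v) \<in> E ^^ j \<and> i + j = m"
  have "?P u" using m by (intro exI[of _ 0] exI[of _ m]) auto
  then obtain h where h: "?P h" and min: "\<And>x. ?P x \<Longrightarrow> \<pi> h \<le> \<pi> x"
    using exists_least_iff[of "\<lambda>r. \<exists>x. ?P x \<and> \<pi> x = r"] by (metis not_less)
  from h obtain i j where ij: "(u, h) \<in> E ^^ i" "(h, v) \<in> E ^^ j" "i + j = m" by blast
  have via: "a + b = m \<and> \<pi> h \<le> \<pi> x" if "(u, x) \<in> E ^^ a" "(x, v) \<in> E ^^ b" "a + b \<le> m" for x a b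
    using that least[OF relpow_trans[OF that(1,2)]] min[of x] by auto
  have "h \<in> V" using ij(1) assms(2) relpow_in_V by blast
  have "hub h i u" unfolding hub_def
  proof (intro conjI allI impI)
    fix x a b assume x: "(h, x) \<in> E ^^ a" "(x, u) \<in> E ^^ b" "a + b \<le> i"
    \<comment> \<open>The walk over \<open>x\<close> is reversed, so that it runs from
      \<open>u\<close> to \<open>h\<close>, and then continued along the second half to
      \<open>v\<close>.\<close>
    have "b + (a + j) = m \<and> \<pi> h \<le> \<pi> x"
      using x(3) ij(3) by (intro via relpow_sym[OF x(2)] relpow_trans[OF relpow_sym[OF x(1)] ij(2)]) simp
    then show "a + b = i" "\<pi> h \<le> \<pi> x" using ij by auto
  qed (use ij relpow_sym \<open>h \<in> V\<close> in auto)
  moreover have "hub h j v" unfolding hub_def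
  proof (intro conjI allI impI)
    fix x a b assume x: "(h, x) \<in> E ^^ a" "(x, v) \<in> E ^^ b" "a + b \<le> j"
    have "(i + a) + b = m \<and> \<pi> h \<le> \<pi> x"
      using x(3) ij(3) by (intro via relpow_trans[OF ij(1) x(1)] x(2)) simp
    then show "a + b = j" "\<pi> h \<le> \<pi> x" using ij by auto
  qed (use ij \<open>h \<in> V\<close> in auto)
  moreover have "i + j \<le> n" using ij(3) least[OF assms(1)] by simp
  ultimately show thesis by (rule that)
qed

lemma finite_hubs: "finite {(u, n). hub u n v}"
proof (rule finite_imageD)
  show "finite (fst ` {(u, n). hub u n v})"
    by (rule finite_subset[OF _ finite_V]) (auto dest: hub_in_V)
  show "inj_on fst {(u, n). hub u n v}"
    by (rule inj_onI) (auto dest: hub_unique)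
qed


section \<open>PLL\<close>

text \<open>Lengths of walks suffice as recorded values, since \<open>hub_via\<close> speaks of all
  walks of length at most \<open>n\<close>.\<close>

definition sound_labels :: "('a \<Rightarrow> 'a label) \<Rightarrow> bool" where
  "sound_labels L \<longleftrightarrow> (\<forall>v h d. (h, d) \<in> L v \<longrightarrow> h \<in> V \<and> (h, v) \<in> E ^^ d)"

text \<open>A refuting vertex \<open>h\<close> lies on a walk of length at most \<open>n\<close>, so
  \<open>\<pi> u \<le> \<pi> h\<close>. The third assumption gives the converse, hence
  \<open>h = u\<close>, which the last assumption excludes from the label of
  \<open>v\<close>.\<close>

lemma hub_positive_check:
  assumes "sound_labels (labels s)" "hub u n v"
    and "\<And>h d. (h, d) \<in> labels s u \<Longrightarrow> \<pi> h \<le> \<pi> u"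
    and "\<And>d. (u, d) \<notin> labels s v"
  shows "positive_check s u n v"
  unfolding positive_check_iff
proof (intro allI impI, rule ccontr)
  fix h d1 d2 assume h: "(h, d1) \<in> labels s u" "(h, d2) \<in> labels s v" "\<not> n < d1 + d2"
  then have "(u, h) \<in> E ^^ d1" "(h, v) \<in> E ^^ d2" "h \<in> V"
    using assms(1) relpow_sym unfolding sound_labels_def by blast+
  then have "\<pi> u \<le> \<pi> h" using hub_via[OF assms(2)] h(3) by fastforce
  then have "\<pi> h = \<pi> u" using assms(3)[OF h(1)] by simp
  then have "h = u" using rank_eqD \<open>h \<in> V\<close> hub_in_V[OF assms(2)] by blast
  then show False using h(2) assms(4) by blast
qed

text \<open>The queue conditions are those of breadth-first search: sorted, with at most two
  consecutive distances. The last two conditions keep track of the vertices with hub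
  \<open>u\<close>: once visited they are labelled or queued, and once labelled their neighbours
  with hub \<open>u\<close> are visited.\<close>

definition pll_inv :: "'a \<Rightarrow> 'a pll_state \<Rightarrow> bool" where
  "pll_inv u s \<longleftrightarrow> u \<in> V \<and> u \<in> visited s \<and> sound_labels (labels s) \<and>
     (\<forall>v. finite (labels s v)) \<and> ordered_pairs V (labels s) \<le> cost s \<and>
     (\<forall>v h d. (h, d) \<in> labels s v \<longrightarrow> \<pi> h < \<pi> u \<or> h = u \<and> v \<in> visited s) \<and>
     (\<forall>v h d. hub h d v \<longrightarrow> \<pi> h < \<pi> u \<longrightarrow> (h, d) \<in> labels s v) \<and>
     sorted (map snd (queue s)) \<and> distinct (map fst (queue s)) \<and>
     (\<forall>p\<in>set (queue s). snd p \<le> Suc (snd (hd (queue s)))) \<and>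
     (\<forall>w e. (w, e) \<in> set (queue s) \<longrightarrow> w \<in> visited s \<and> (u, w) \<in> E ^^ e \<and> (\<forall>d. (u, d) \<notin> labels s w) \<and>
        (\<forall>n. hub u n w \<longrightarrow> e = n)) \<and>
     (\<forall>w n. hub u n w \<longrightarrow> w \<in> visited s \<longrightarrow> (u, n) \<in> labels s w \<or> (w, n) \<in> set (queue s)) \<and>
     (\<forall>w n w' n'. hub u n w \<longrightarrow> (u, n) \<in> labels s w \<longrightarrow> (w, w') \<in> E \<longrightarrow> hub u n' w' \<longrightarrow> w' \<in> visited s)"

text \<open>Going back along a shortest path leads to a missing entry that is at \<open>u\<close> or
  has a labelled predecessor; its vertex was visited, so it is still queued. For an empty queue this
  is completeness of the search.\<close>

lemma pll_inv_pending:
  assumes "pll_inv u s" "hub u n w" "(u, n) \<notin> labels s w"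
  shows "\<exists>w' m. m \<le> n \<and> (w', m) \<in> set (queue s)"
  using assms(2,3)
proof (induction n arbitrary: w)
  case 0
  then show ?case using assms(1) unfolding pll_inv_def hub_0 by (metis hub_0 le0)
next
  case (Suc n)
  then obtain p where p: "hub u n p" "(p, w) \<in> E" by (blast elim: hub_pred)
  show ?case
  proof (cases "(u, n) \<in> labels s p")
    case True
    then have "w \<in> visited s" using assms(1) p Suc.prems(1) unfolding pll_inv_def by blast
    then have "(w, Suc n) \<in> set (queue s)" using assms(1) Suc.prems unfolding pll_inv_def by blast
    then show ?thesis by blast
  next
    case False
    then show ?thesis using Suc.IH[OF p(1)] le_SucI by blast
  qed
qed

text \<open>The predecessor of \<open>w\<close> on a shortest path is not labelled, so an entry of
  distance at most \<open>n - 1\<close> is pending, and the head of the sorted queue is no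
  farther.\<close>

lemma pll_inv_unvisited:
  assumes "pll_inv u s" "queue s = (v, d) # Q" "hub u n w" "w \<notin> visited s"
  shows "d < n"
proof (cases n)
  case 0
  then show ?thesis using assms unfolding pll_inv_def hub_0 by (metis hub_0)
next
  case (Suc k)
  then obtain p where p: "hub u k p" "(p, w) \<in> E" using assms(3) by (blast elim: hub_pred)
  then have "(u, k) \<notin> labels s p" using assms(1,3,4) unfolding pll_inv_def by blast
  then obtain w' m where "m \<le> k" "(w', m) \<in> set (queue s)"
    using pll_inv_pending[OF assms(1) p(1)] by blast
  moreover from this have "d \<le> m" using assms(1,2) unfolding pll_inv_def by force
  ultimately show ?thesis using Suc by simp
qed

text \<open>The order in which the neighbours are treated survives only as the order of
  \<open>ws\<close>.\<close>

lemma pll_enqueue_all: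
  assumes "for_set (pll_enqueue \<pi> u d) X s t"
  obtains ws where "distinct ws" "set ws = {w \<in> X. w \<notin> visited s \<and> \<pi> u < \<pi> w}"
    "t = s\<lparr>visited := visited s \<union> set ws, queue := queue s @ map (\<lambda>w. (w, d + 1)) ws\<rparr>"
proof -
  let ?I = "\<lambda>Y t. \<exists>ws. distinct ws \<and> set ws = {w \<in> Y. w \<notin> visited s \<and> \<pi> u < \<pi> w} \<and>
    t = s\<lparr>visited := visited s \<union> set ws, queue := queue s @ map (\<lambda>w. (w, d + 1)) ws\<rparr>"
  have "?I X t"
  proof (rule for_set_invariant[OF assms])
    show "?I {} s" by (intro exI[of _ "[]"]) auto
  next
    fix x Y r t assume "x \<notin> Y" "?I Y r" and t: "pll_enqueue \<pi> u d x r t"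
    then obtain ws where ws: "distinct ws" "set ws = {w \<in> Y. w \<notin> visited s \<and> \<pi> u < \<pi> w}"
      "r = s\<lparr>visited := visited s \<union> set ws, queue := queue s @ map (\<lambda>w. (w, d + 1)) ws\<rparr>" by blast
    show "?I (insert x Y) t"
    proof (cases "x \<notin> visited s \<and> \<pi> u < \<pi> x")
      case True
      with ws t \<open>x \<notin> Y\<close> show ?thesis
        by (intro exI[of _ "ws @ [x]"]) (auto simp: pll_enqueue_def)
    next
      case False
      with ws t show ?thesis by (intro exI[of _ ws]) (auto simp: pll_enqueue_def)
    qed
  qed
  then show thesis using that by blast
qed

text \<open>All distances are \<open>d\<close> or \<open>Suc d\<close>, so the bound holds whichever
  entry has become the head.\<close>

lemma near_head:
  assumes "\<And>w e. (w, e) \<in> set q \<Longrightarrow> d \<le> e \<and> e \<le> Suc d" "p \<in> set q"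
  shows "snd p \<le> Suc (snd (hd q))"
proof -
  have "hd q \<in> set q" using assms(2) by (cases q) auto
  then have "d \<le> snd (hd q)" "snd p \<le> Suc d" using assms by (metis prod.collapse)+
  then show ?thesis by simp
qed

lemma pll_inv_queueD:
  assumes inv: "pll_inv u s" and q: "queue s = (v, d) # Q"
  shows "v \<in> visited s" "(u, v) \<in> E ^^ d" "(u, e) \<notin> labels s v" "hub u n v \<Longrightarrow> d = n"
    and "(w, e) \<in> set Q \<Longrightarrow> d \<le> e \<and> e \<le> Suc d \<and> w \<noteq> v \<and> w \<in> visited s \<and> (u, w) \<in> E ^^ e \<and>
      (\<forall>d. (u, d) \<notin> labels s w) \<and> (\<forall>n. hub u n w \<longrightarrow> e = n)"
    and "sorted (map snd Q)" "distinct (map fst Q)"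
proof -
  have sd: "sorted (map snd (queue s))" "distinct (map fst (queue s))"
    and bound: "\<And>p. p \<in> set (queue s) \<Longrightarrow> snd p \<le> Suc (snd (hd (queue s)))"
    and entry: "\<And>w e. (w, e) \<in> set (queue s) \<Longrightarrow> w \<in> visited s \<and> (u, w) \<in> E ^^ e \<and>
      (\<forall>d. (u, d) \<notin> labels s w) \<and> (\<forall>n. hub u n w \<longrightarrow> e = n)"
    using inv unfolding pll_inv_def by blast+
  show "v \<in> visited s" "(u, v) \<in> E ^^ d" "(u, e) \<notin> labels s v" "hub u n v \<Longrightarrow> d = n"
    using entry[of v d] by (auto simp: q)
  show "sorted (map snd Q)" "distinct (map fst Q)" using sd by (auto simp: q)
  assume w: "(w, e) \<in> set Q"
  have "d \<le> e" "w \<noteq> v" using sd w by (force simp: q)+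
  moreover have "e \<le> Suc d" using bound[of "(w, e)"] w by (simp add: q)
  ultimately show "d \<le> e \<and> e \<le> Suc d \<and> w \<noteq> v \<and> w \<in> visited s \<and> (u, w) \<in> E ^^ e \<and>
      (\<forall>d. (u, d) \<notin> labels s w) \<and> (\<forall>n. hub u n w \<longrightarrow> e = n)"
    using entry[of w e] w by (simp add: q)
qed

text \<open>The failed check shows that \<open>u\<close> is not a hub of \<open>v\<close>, so
  pruning here loses no canonical entry.\<close>

lemma pll_inv_negative:
  assumes inv: "pll_inv u s" and q: "queue s = (v, d) # Q" and neg: "\<not> positive_check s u d v"
  shows "pll_inv u (s\<lparr>queue := Q\<rparr>)"
proof -
  have "\<not> hub u n v" for n
  proof
    assume n: "hub u n v"
    then have "d = n" using inv q unfolding pll_inv_def by auto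
    have "positive_check s u n v"
    proof (rule hub_positive_check[OF _ n])
      show "sound_labels (labels s)" using inv unfolding pll_inv_def by blast
      show "\<And>h d. (h, d) \<in> labels s u \<Longrightarrow> \<pi> h \<le> \<pi> u"
        using inv unfolding pll_inv_def by (metis less_imp_le order_refl)
      show "\<And>d. (u, d) \<notin> labels s v" using inv q unfolding pll_inv_def by auto
    qed
    then show False using neg \<open>d = n\<close> by simp
  qed
  moreover have "(u, n) \<in> labels s w \<or> (w, n) \<in> set (queue s)" if "hub u n w" "w \<in> visited s" for w n
    using inv that unfolding pll_inv_def by blast
  ultimately have "\<forall>w n. hub u n w \<longrightarrow> w \<in> visited s \<longrightarrow> (u, n) \<in> labels s w \<or> (w, n) \<in> set Q"
    using q by fastforce
  moreover have "\<forall>p\<in>set Q. snd p \<le> Suc (snd (hd Q))"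
    using pll_inv_queueD(5)[OF inv q] by (intro ballI near_head[of Q d]) auto
  ultimately show ?thesis using inv pll_inv_queueD(5-7)[OF inv q] unfolding pll_inv_def by simp
qed

lemma pll_inv_positive:
  assumes inv: "pll_inv u s" and q: "queue s = (v, d) # Q" and pos: "positive_check s u d v"
    and ws: "distinct ws" "set ws = {w. (v, w) \<in> E \<and> w \<notin> visited s \<and> \<pi> u < \<pi> w}"
    and t: "queue t = Q @ map (\<lambda>w. (w, d + 1)) ws" "visited t = visited s \<union> set ws"
      "labels t = (labels s)(v := insert (u, d) (labels s v))"
      "cost t = cost s + card (labels s v)"
  shows "pll_inv u t"
proof -
  note v = pll_inv_queueD(1-4)[OF inv q] and Q = pll_inv_queueD(5)[OF inv q]
    and sQ = pll_inv_queueD(6,7)[OF inv q]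
  have u: "u \<in> V" "u \<in> visited s" using inv unfolding pll_inv_def by blast+
  have fin: "finite (labels s v)" and lab: "\<And>v h d. (h, d) \<in> labels s v \<Longrightarrow> \<pi> h < \<pi> u \<or> h = u \<and> v \<in> visited s"
    using inv unfolding pll_inv_def by blast+
  have new: "(u, w) \<in> E ^^ Suc d \<and> w \<notin> visited s \<and> w \<noteq> v \<and> (\<forall>d. (u, d) \<notin> labels s w) \<and>
      (\<forall>n. hub u n w \<longrightarrow> Suc d = n)" if "w \<in> set ws" for w
  proof -
    have w: "(v, w) \<in> E" "w \<notin> visited s" using that ws(2) by auto
    then have walk: "(u, w) \<in> E ^^ Suc d" using v(2) by (blast intro: relpow_Suc_I)
    \<comment> \<open>The walk through \<open>v\<close> gives \<open>n \<le> Suc d\<close>, and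
      \<open>w\<close> being unvisited gives \<open>d < n\<close>: a vertex with hub
      \<open>u\<close> is first reached at its true distance.\<close>
    then have "Suc d = n" if "hub u n w" for n
      using hub_dist_le[OF that walk] pll_inv_unvisited[OF inv q that w(2)] by simp
    with w walk lab v(1) show ?thesis by blast
  qed
  have sound: "sound_labels (labels t)"
    using inv v u t(3) unfolding pll_inv_def sound_labels_def by auto
  have "ordered_pairs V (labels t) \<le> cost t"
  proof -
    have "v \<in> V" using v(2) u(1) relpow_in_V by blast
    \<comment> \<open>The entry is new, so the label grows by exactly one and the sum by exactly the
      cost of this check.\<close>
    have "card (insert (u, d) (labels s v)) = Suc (card (labels s v))" using fin v(3) by simp
    then have "ordered_pairs V (labels t) = ordered_pairs V (labels s) + card (labels s v)"
      using ordered_pairs_upd[OF finite_V \<open>v \<in> V\<close>, of "labels s" "insert (u, d) (labels s v)"]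
      unfolding t(3) by simp
    then show ?thesis using inv unfolding pll_inv_def t(4) by simp
  qed
  moreover have "sorted (map snd (queue t))"
    using sQ(1) Q by (auto simp: t(1) sorted_append comp_def map_replicate_const)
  moreover have "distinct (map fst (queue t))"
  proof -
    have "fst ` set Q \<inter> set ws = {}" using Q new by fastforce
    then show ?thesis using sQ(2) ws(1) by (simp add: t(1) comp_def)
  qed
  moreover have "\<forall>p\<in>set (queue t). snd p \<le> Suc (snd (hd (queue t)))"
    using Q by (intro ballI near_head[of _ d]) (auto simp: t(1))
  moreover have "w \<in> visited t \<and> (u, w) \<in> E ^^ e \<and> (\<forall>d. (u, d) \<notin> labels t w) \<and> (\<forall>n. hub u n w \<longrightarrow> e = n)"
    if "(w, e) \<in> set (queue t)" for w e
    using that Q[of w e] new[of w] by (auto simp: t)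
  moreover have "(u, n) \<in> labels t w \<or> (w, n) \<in> set (queue t)" if "hub u n w" "w \<in> visited t" for w n
  proof (cases "w \<in> visited s")
    case True
    then have "(u, n) \<in> labels s w \<or> (w, n) \<in> set (queue s)" using that(1) inv unfolding pll_inv_def by blast
    then show ?thesis using q by (auto simp: t)
  next
    case False
    then show ?thesis using that new[of w] by (auto simp: t)
  qed
  moreover have "w' \<in> visited t" if "hub u n w" "(u, n) \<in> labels t w" "(w, w') \<in> E" "hub u n' w'" for w n w' n'
  proof (cases "w = v")
    case True
    \<comment> \<open>The rank test does not block \<open>w'\<close>: either \<open>u\<close> ranks
      above it, or \<open>w' = u\<close>, which is visited.\<close>
    then have "w' \<in> set ws \<or> w' \<in> visited s"
      using that hub_rank_less[OF that(4)] u(2) unfolding ws(2) by blast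
    then show ?thesis by (auto simp: t)
  next
    case False
    then have "w' \<in> visited s" using that inv unfolding t(3) pll_inv_def by (metis fun_upd_other)
    then show ?thesis by (auto simp: t)
  qed
  moreover have "\<pi> h < \<pi> u \<or> h = u \<and> w \<in> visited t" if "(h, e) \<in> labels t w" for w h e
    using that lab[of h e w] v(1) by (auto simp: t split: if_splits)
  moreover have "(h, e) \<in> labels t w" if "hub h e w" "\<pi> h < \<pi> u" for w h e
    using that inv unfolding pll_inv_def by (auto simp: t(3))
  moreover have "\<forall>w. finite (labels t w)" using inv unfolding pll_inv_def by (auto simp: t(3))
  moreover have "u \<in> visited t" using u by (simp add: t)
  ultimately show ?thesis using u(1) sound unfolding pll_inv_def by blast
qed

section \<open>Complete PLL runs and the lower bound\<close>

text \<open>Here \<open>i\<close> is the rank of the next source.\<close>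

definition pll_done :: "nat \<Rightarrow> 'a pll_state \<Rightarrow> bool" where
  "pll_done i s \<longleftrightarrow> sound_labels (labels s) \<and>
     (\<forall>v. finite (labels s v)) \<and> ordered_pairs V (labels s) \<le> cost s \<and>
     (\<forall>v h d. (h, d) \<in> labels s v \<longrightarrow> \<pi> h < i) \<and>
     (\<forall>v h d. hub h d v \<longrightarrow> \<pi> h < i \<longrightarrow> (h, d) \<in> labels s v)"

lemma pll_source_done:
  assumes "parcs G = E" "pll_source G \<pi> u s t" "pll_done (\<pi> u) s" "u \<in> V"
  shows "pll_done (Suc (\<pi> u)) t"
proof -
  have "pll_inv u (s\<lparr>queue := [(u, 0)], visited := {u}\<rparr>)"
    using assms(3,4) unfolding pll_inv_def pll_done_def by (auto dest: hub_self simp: hub_0)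
  then have inv: "pll_inv u t \<and> \<not> queue t \<noteq> []"
  proof (rule while_loop_invariant[OF assms(2)[unfolded pll_source_def]])
    fix s t assume inv: "pll_inv u s" and "pll_pop G \<pi> u s t"
    then obtain v d Q where q: "queue s = (v, d) # Q"
      and pop: "if positive_check s u d v
         then for_set (pll_enqueue \<pi> u d) {w. (v, w) \<in> E} (pll_add u d v (count_check v (s\<lparr>queue := Q\<rparr>))) t
         else t = s\<lparr>queue := Q\<rparr>" unfolding pll_pop_def assms(1) by blast
    show "pll_inv u t"
    proof (cases "positive_check s u d v")
      case True
      with pop have "for_set (pll_enqueue \<pi> u d) {w. (v, w) \<in> E} (pll_add u d v (count_check v (s\<lparr>queue := Q\<rparr>))) t"
        by simp
      then obtain ws where ws: "distinct ws" "set ws = {w. (v, w) \<in> E \<and> w \<notin> visited s \<and> \<pi> u < \<pi> w}"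
        and "queue t = Q @ map (\<lambda>w. (w, d + 1)) ws" "visited t = visited s \<union> set ws"
          "labels t = (labels s)(v := insert (u, d) (labels s v))" "cost t = cost s + card (labels s v)"
        by (rule pll_enqueue_all) (simp add: pll_add_def count_check_def)
      then show ?thesis by (rule pll_inv_positive[OF inv q True])
    next
      case False
      with pop pll_inv_negative[OF inv q] show ?thesis by simp
    qed
  qed
  have "(h, d) \<in> labels t v" if "hub h d v" "\<pi> h < Suc (\<pi> u)" for v h d
  proof (cases "\<pi> h < \<pi> u")
    case True
    with that inv show ?thesis unfolding pll_inv_def by blast
  next
    case False
    with that have "h = u" using rank_eqD hub_in_V assms(4) by (metis less_SucE)
    then show ?thesis using inv pll_inv_pending[of u t d v] that(1) by auto
  qed
  moreover have "\<pi> h < Suc (\<pi> u)" if "(h, d) \<in> labels t v" for v h d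
    using inv that unfolding pll_inv_def by (metis less_Suc_eq)
  moreover have "sound_labels (labels t)" "\<forall>v. finite (labels t v)" "ordered_pairs V (labels t) \<le> cost t"
    using inv unfolding pll_inv_def by blast+
  ultimately show ?thesis unfolding pll_done_def by blast
qed

lemma pll_cost_ge:
  assumes "parcs G = E" "pverts G = V" "bij_betw \<pi> V {1..card V}" "pll_run G \<pi> s"
  shows "ordered_pairs V (\<lambda>v. {(u, n). hub u n v}) \<le> cost s"
proof -
  have "pll_done (card V + 1) s"
  proof (rule for_list_upt_invariant[OF assms(4)[unfolded pll_run_def assms(2)]])
    show "pll_done 1 pll_init"
      using bij_betwE[OF assms(3)] hub_in_V
      by (fastforce simp: pll_done_def pll_init_def sound_labels_def ordered_pairs_def)
  next
    fix i s t assume i: "1 \<le> i" "i < card V + 1" and "pll_done i s"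
      and "pll_source G \<pi> (inv_into V \<pi> i) s t"
    moreover have "\<pi> (inv_into V \<pi> i) = i" "inv_into V \<pi> i \<in> V"
      using assms(3) i by (auto simp: bij_betw_def f_inv_into_f inv_into_into)
    ultimately show "pll_done (Suc i) t" using pll_source_done[OF assms(1), of "inv_into V \<pi> i" s t] by simp
  qed simp
  then have complete: "\<And>v h d. hub h d v \<Longrightarrow> \<pi> h < card V + 1 \<Longrightarrow> (h, d) \<in> labels s v"
    and fin: "\<And>v. finite (labels s v)" and cost: "ordered_pairs V (labels s) \<le> cost s"
    unfolding pll_done_def by blast+
  have "\<pi> u < card V + 1" if "u \<in> V" for u using bij_betwE[OF assms(3)] that by fastforce
  then have "{(u, n). hub u n v} \<subseteq> labels s v" for v using complete hub_in_V(1) by blast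
  then have "ordered_pairs V (\<lambda>v. {(u, n). hub u n v}) \<le> ordered_pairs V (labels s)"
    using fin by (rule ordered_pairs_mono)
  then show ?thesis using cost by (rule order_trans)
qed


section \<open>BVC-PLL\<close>

text \<open>
  State after \<open>k\<close> iterations of the batch \<open>B\<close>, where \<open>P\<close> is the union of the earlier batches:
  \<open>level\<close> gives the labels, \<open>front\<close> the new labels, \<open>flagged\<close> the flags, and \<open>sent\<close> the messages of the
  next iteration.
\<close>

definition level :: "'a set \<Rightarrow> 'a set \<Rightarrow> nat \<Rightarrow> 'a \<Rightarrow> 'a label" where
  "level P B k v = {(u, n). hub u n v \<and> (u \<in> P \<or> u \<in> B \<and> n \<le> k)}"

definition front :: "'a set \<Rightarrow> nat \<Rightarrow> 'a \<Rightarrow> 'a label" where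
  "front B k v = {(u, n). hub u n v \<and> u \<in> B \<and> n = k}"

definition flagged :: "'a set \<Rightarrow> nat \<Rightarrow> 'a \<Rightarrow> 'a set" where
  "flagged B k v = {u \<in> B. \<pi> u < \<pi> v \<and> (\<exists>a n. (a, v) \<in> E \<and> n < k \<and> hub u n a)}"

definition sent :: "'a set \<Rightarrow> nat \<Rightarrow> 'a \<Rightarrow> 'a label" where
  "sent B k v = {(u, n). n = Suc k \<and> u \<in> B \<and> \<pi> u < \<pi> v \<and> u \<notin> flagged B k v \<and> (\<exists>a. (a, v) \<in> E \<and> hub u k a)}"

section \<open>Labels, flags and messages of successive iterations\<close>

lemma finite_level: "finite (level P B k v)"
  by (rule finite_subset[OF _ finite_hubs[of v]]) (auto simp: level_def)

lemma level_Suc: "level P B (Suc k) v = level P B k v \<union> front B (Suc k) v"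
  by (auto simp: level_def front_def)

lemma finite_front: "finite (front B k v)"
  by (rule finite_subset[OF _ finite_hubs[of v]]) (auto simp: front_def)

lemma level_front_disjoint: "P \<inter> B = {} \<Longrightarrow> level P B k v \<inter> front B (Suc k) v = {}"
  by (auto simp: level_def front_def)

lemma flagged_Suc: "flagged B (Suc k) v = flagged B k v \<union> fst ` sent B k v"
  by (auto simp: flagged_def sent_def less_Suc_eq image_iff; blast)

text \<open>The predecessor on a shortest path sends the entry, and no earlier flag blocks it, since
  such a flag would come from a walk of length at most \<open>k\<close>.\<close>

lemma front_subset_sent: "front B (Suc k) v \<subseteq> sent B k v"
proof
  fix p assume "p \<in> front B (Suc k) v"
  then obtain u where p: "p = (u, Suc k)" and u: "hub u (Suc k) v" "u \<in> B" by (auto simp: front_def)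
  obtain a where a: "hub u k a" "(a, v) \<in> E" using u(1) by (rule hub_pred)
  have "u \<noteq> v" using u(1) hub_self by blast
  moreover have "u \<notin> flagged B k v"
  proof
    assume "u \<in> flagged B k v"
    then obtain b n where b: "(b, v) \<in> E" "n < k" "hub u n b" by (auto simp: flagged_def)
    then have "(u, v) \<in> E ^^ Suc n" using hub_walk relpow_Suc_I by fast
    then have "Suc k \<le> Suc n" using hub_dist_le u(1) by blast
    with b(2) show False by simp
  qed
  ultimately show "p \<in> sent B k v"
    using p u a hub_rank_less[OF u(1)] by (auto simp: sent_def)
qed

end

section \<open>A single batch of BVC-PLL\<close>

text \<open>\<open>down_closed\<close> records that batches are cut along the ranks: all hubs of a
  vertex of \<open>B\<close> lie in \<open>P\<close> or \<open>B\<close>, so none of them belongs to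
  a later batch.\<close>

locale bvc_batch_context = ranked_graph +
  fixes P B :: "'a set"
  assumes B_subset: "B \<subseteq> V" and disjoint: "P \<inter> B = {}"
    and down_closed: "\<And>u h. u \<in> B \<Longrightarrow> h \<in> V \<Longrightarrow> \<pi> h \<le> \<pi> u \<Longrightarrow> h \<in> P \<union> B"
begin

text \<open>While the vertices are gathered one by one, \<open>u\<close> may already have its new entries.\<close>

lemma positive_check_sent:
  assumes m: "(u, n) \<in> sent B k v"
    and Lv: "labels s v = level P B k v"
    and L: "\<And>w. labels s w = level P B k w \<or> labels s w = level P B (Suc k) w"
  shows "positive_check s u n v \<longleftrightarrow> (u, n) \<in> front B (Suc k) v"
proof
  obtain a where n: "n = Suc k" and u: "u \<in> B" "u \<in> V" "\<pi> u < \<pi> v" "u \<notin> flagged B k v"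
    and a: "(a, v) \<in> E" "hub u k a" using m B_subset by (auto simp: sent_def)
  assume "(u, n) \<in> front B (Suc k) v"
  then have hub: "hub u n v" by (auto simp: front_def)
  show "positive_check s u n v"
  proof (rule hub_positive_check[OF _ hub])
    show "sound_labels (labels s)" unfolding sound_labels_def
    proof (intro allI impI)
      fix w h d assume "(h, d) \<in> labels s w"
      then have "hub h d w" using L[of w] by (auto simp: level_def)
      then show "h \<in> V \<and> (h, w) \<in> E ^^ d" using hub_in_V hub_walk by blast
    qed
  next
    fix h d assume "(h, d) \<in> labels s u"
    then show "\<pi> h \<le> \<pi> u" using L[of u] hub_rank by (auto simp: level_def)
  next
    fix d show "(u, d) \<notin> labels s v"
      using hub hub_unique[of u d v n] u(1) disjoint unfolding Lv n by (auto simp: level_def)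
  qed
next
  obtain a where n: "n = Suc k" and u: "u \<in> B" "u \<in> V" "\<pi> u < \<pi> v" "u \<notin> flagged B k v"
    and a: "(a, v) \<in> E" "hub u k a" using m B_subset by (auto simp: sent_def)
  assume pos: "positive_check s u n v"
  have "(u, v) \<in> E ^^ Suc k" using a hub_walk relpow_Suc_I by fast
  then obtain h i j where h: "hub h i u" "hub h j v" "i + j \<le> Suc k"
    using common_hub u(2) by blast
  have "\<pi> h \<le> \<pi> u" using hub_rank h(1) by blast
  then have PB: "h \<in> P \<union> B" using down_closed u(1) hub_in_V h(1) by blast
  show "(u, n) \<in> front B (Suc k) v"
  proof (cases "h = u")
    case True
    \<comment> \<open>Were \<open>v\<close> closer to \<open>u\<close>, the predecessor on a
      shortest path would have caused \<open>u\<close> to be flagged at \<open>v\<close>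
      before.\<close>
    have "j = Suc k"
    proof (rule ccontr)
      assume "j \<noteq> Suc k"
      then have "j \<le> k" using h(3) by simp
      have "j \<noteq> 0" using h(2) True u(3) hub_0 by (cases j) auto
      then obtain j' where j': "j = Suc j'" by (cases j) auto
      obtain p where "hub u j' p" "(p, v) \<in> E" using h(2) unfolding True j' by (rule hub_pred)
      moreover have "j' < k" using \<open>j \<le> k\<close> j' by simp
      ultimately have "u \<in> flagged B k v" using u by (auto simp: flagged_def)
      then show False using u(4) by blast
    qed
    then show ?thesis using h(2) True u(1) n by (simp add: front_def)
  next
    case False
    have "h \<noteq> v" using \<open>\<pi> h \<le> \<pi> u\<close> u(3) by auto
    \<comment> \<open>\<open>h\<close> differs from both ends, so both parts have length at most
      \<open>k\<close>, and both entries are present whether or not \<open>u\<close> already has its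
      new ones.\<close>
    then have "i \<noteq> 0" "j \<noteq> 0" using h False hub_0 by metis+
    then have "i \<le> k" "j \<le> k" using h(3) by auto
    then have "(h, i) \<in> level P B k u" "(h, j) \<in> level P B k v" using h PB by (auto simp: level_def)
    then have "(h, i) \<in> labels s u" "(h, j) \<in> labels s v" using L[of u] Lv by (auto simp: level_Suc)
    then have "n < i + j" using pos unfolding positive_check_iff by blast
    then show ?thesis using h(3) n by simp
  qed
qed

text \<open>\<open>delta\<close> is described at active vertices only: the scatter reads it nowhere
  else, and stale values may remain there.\<close>

definition bvc_inv :: "nat \<Rightarrow> 'a bvc_state \<Rightarrow> bool" where
  "bvc_inv k s \<longleftrightarrow> labels s = level P B k \<and> active s = {v. front B k v \<noteq> {}} \<and>
     (\<forall>v\<in>active s. delta s v = front B k v) \<and> flags s = flagged B k \<and>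
     cost s \<le> ordered_pairs V (labels s)"

text \<open>All new labels hold the same distance \<open>k\<close>, so the message does not depend
  on which active neighbour is first to flag \<open>u\<close> at \<open>v\<close>.\<close>

lemma bvc_scatter_sent:
  assumes "parcs G = E" "bvc_inv k s" "bvc_scatter G \<pi> (s\<lparr>msgs := (\<lambda>_. {})\<rparr>) t"
  shows "labels t = level P B k" "active t = {}" "flags t = flagged B (Suc k)" "msgs t = sent B k"
    "cost t = cost s"
proof -
  let ?X = "{(a, v, u, d). a \<in> active s \<and> (a, v) \<in> E \<and> (u, d) \<in> delta s a}"
  \<comment> \<open>The vertices newly flagged at \<open>v\<close> by the triples in
    \<open>Y\<close>, where new refers to the flags before the scatter.\<close>
  let ?N = "\<lambda>(Y :: ('a \<times> 'a \<times> 'a \<times> nat) set) v. {u. \<pi> u < \<pi> v \<and> u \<notin> flagged B k v \<and> (\<exists>a. (a, v, u, k) \<in> Y)}"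
  let ?I = "\<lambda>Y r. labels r = level P B k \<and> cost r = cost s \<and> msgs r = (\<lambda>v. ?N Y v \<times> {Suc k}) \<and>
    flags r = (\<lambda>v. flagged B k v \<union> ?N Y v)"
  have X: "(a, v, u, d) \<in> ?X \<longleftrightarrow> (a, v) \<in> E \<and> hub u k a \<and> u \<in> B \<and> d = k" for a v u d
  proof -
    have a: "a \<in> active s \<longleftrightarrow> front B k a \<noteq> {}" and d: "a \<in> active s \<Longrightarrow> delta s a = front B k a"
      using assms(2) by (auto simp: bvc_inv_def)
    show ?thesis using a d by (cases "a \<in> active s") (auto simp: front_def)
  qed
  obtain r where r: "for_set (bvc_send \<pi>) ?X (s\<lparr>msgs := (\<lambda>_. {})\<rparr>) r" "t = r\<lparr>active := {}\<rparr>"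
    using assms(3) unfolding bvc_scatter_def assms(1) by auto
  have I: "?I ?X r"
  proof (rule for_set_invariant[OF r(1)])
    show "?I {} (s\<lparr>msgs := (\<lambda>_. {})\<rparr>)" using assms(2) by (auto simp: bvc_inv_def)
  next
    fix x Y p q assume "x \<in> ?X" and I: "?I Y p" and q: "bvc_send \<pi> x p q"
    then obtain a v u where x: "x = (a, v, u, k)" by (cases x) (use X in blast)
    show "?I (insert x Y) q"
    proof (cases "\<pi> u < \<pi> v \<and> u \<notin> flags p v")
      case True
      with I q show ?thesis by (auto simp: x bvc_send_def fun_eq_iff)
    next
      case False
      with I have N: "?N (insert x Y) w = ?N Y w" for w by (auto simp: x)
      have "q = p" using q False by (auto simp: x bvc_send_def)
      then show ?thesis unfolding N using I by blast
    qed
  qed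
  have "?N ?X v \<times> {Suc k} = sent B k v" for v unfolding sent_def using X by auto
  moreover from this[symmetric] have "flagged B k v \<union> ?N ?X v = flagged B (Suc k) v" for v
    unfolding flagged_Suc by simp
  ultimately show "labels t = level P B k" "active t = {}" "flags t = flagged B (Suc k)" "msgs t = sent B k"
    "cost t = cost s" using I r(2) by simp_all
qed

text \<open>Labels change only at the commit: all messages of \<open>v\<close> meet the same labels,
  and each positive check costs the old size of the label of \<open>v\<close>.\<close>

lemma bvc_receive_front:
  assumes r: "for_set (bvc_receive v) (sent B k v) (s\<lparr>delta := (delta s)(v := {})\<rparr>) r"
    and Lv: "labels s v = level P B k v"
    and L: "\<And>w. labels s w = level P B k w \<or> labels s w = level P B (Suc k) w"
  shows "r = s\<lparr>delta := (delta s)(v := front B (Suc k) v),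
    cost := cost s + card (front B (Suc k) v) * card (labels s v)\<rparr>"
proof -
  let ?F = "front B (Suc k) v"
  have fin: "finite ?F" by (rule finite_front)
  have "r = s\<lparr>delta := (delta s)(v := sent B k v \<inter> ?F),
    cost := cost s + card (sent B k v \<inter> ?F) * card (labels s v)\<rparr>"
  proof (rule for_set_invariant[OF r])
    show "s\<lparr>delta := (delta s)(v := {})\<rparr> = s\<lparr>delta := (delta s)(v := {} \<inter> ?F),
      cost := cost s + card ({} \<inter> ?F) * card (labels s v)\<rparr>" by simp
  next
    fix x Y p q
    assume x: "x \<in> sent B k v" "x \<notin> Y" and q: "bvc_receive v x p q"
      and p: "p = s\<lparr>delta := (delta s)(v := Y \<inter> ?F), cost := cost s + card (Y \<inter> ?F) * card (labels s v)\<rparr>"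
    obtain u n where un: "x = (u, n)" by (cases x)
    have "positive_check p u n v \<longleftrightarrow> x \<in> ?F"
      using positive_check_sent[of u n k v p] x(1) Lv L by (simp add: p un)
    then show "q = s\<lparr>delta := (delta s)(v := insert x Y \<inter> ?F),
        cost := cost s + card (insert x Y \<inter> ?F) * card (labels s v)\<rparr>"
      using q x(2) fin by (auto simp: un bvc_receive_def p count_check_def)
  qed
  moreover have "sent B k v \<inter> ?F = ?F" using front_subset_sent by blast
  ultimately show ?thesis by simp
qed

lemma bvc_iteration_inv:
  assumes "parcs G = E" "bvc_inv k s" "bvc_iteration G \<pi> s t"
  shows "bvc_inv (Suc k) t"
proof -
  obtain r where "bvc_scatter G \<pi> (s\<lparr>msgs := (\<lambda>_. {})\<rparr>) r" and gather: "bvc_gather r t"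
    using assms(3) unfolding bvc_iteration_def by blast
  note r = bvc_scatter_sent[OF assms(1,2) this(1)]
  let ?X = "{v. sent B k v \<noteq> {}}"
  \<comment> \<open>In the middle of the gather phase the vertices in \<open>Y\<close> have their
    new entries and the others do not, a mixture that \<open>positive_check_sent\<close>
    admits.\<close>
  let ?I = "\<lambda>Y p. labels p = (\<lambda>v. if v \<in> Y then level P B (Suc k) v else level P B k v) \<and>
    active p = {v \<in> Y. front B (Suc k) v \<noteq> {}} \<and> (\<forall>v\<in>Y. delta p v = front B (Suc k) v) \<and>
    flags p = flagged B (Suc k) \<and> msgs p = sent B k \<and> cost p \<le> ordered_pairs V (labels p)"
  have I: "?I ?X t"
  proof (rule for_set_invariant[OF gather[unfolded bvc_gather_def r]])
    show "?I {} r" using r assms(2) unfolding bvc_inv_def by (metis (no_types, lifting) empty_iff empty_Collect_eq)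
  next
    fix v Y p q assume v: "v \<in> ?X" "v \<notin> Y" and I: "?I Y p" and q: "bvc_gather_at v p q"
    let ?F = "front B (Suc k) v"
    have Lv: "labels p v = level P B k v" using I v by simp
    from q I obtain p' where p': "for_set (bvc_receive v) (sent B k v) (p\<lparr>delta := (delta p)(v := {})\<rparr>) p'"
      "q = bvc_commit v p'" unfolding bvc_gather_at_def by auto
    have p'_eq: "p' = p\<lparr>delta := (delta p)(v := ?F), cost := cost p + card ?F * card (labels p v)\<rparr>"
      by (rule bvc_receive_front[OF p'(1) Lv]) (use I in simp)
    have q: "q = p\<lparr>delta := (delta p)(v := ?F), cost := cost p + card ?F * card (labels p v),
        labels := (labels p)(v := level P B (Suc k) v),
        active := (if ?F = {} then active p else insert v (active p))\<rparr>"
      unfolding p'(2) bvc_commit_def p'_eq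
      by (rule bvc_state.equality) (use Lv in \<open>auto simp: level_Suc fun_eq_iff\<close>)
    have "v \<in> V" using v(1) E_subset by (auto simp: sent_def)
    have "finite ?F" by (rule finite_front)
    then have "card (level P B (Suc k) v) = card (level P B k v) + card ?F"
      unfolding level_Suc using finite_level level_front_disjoint[OF disjoint] by (rule_tac card_Un_disjoint)
    \<comment> \<open>On the left every entry of \<open>?F\<close> pays the old size; on the right
      the sizes increase with each entry.\<close>
    then have "ordered_pairs V (labels p) + card ?F * card (labels p v)
        \<le> ordered_pairs V ((labels p)(v := level P B (Suc k) v))"
      using ordered_pairs_upd[OF finite_V \<open>v \<in> V\<close>, of "labels p" "level P B (Suc k) v"]
        sum_lessThan_add_ge[of "card (level P B k v)" "card ?F"] Lv by simp
    moreover have "cost p \<le> ordered_pairs V (labels p)" using I by blast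
    ultimately have "cost q \<le> ordered_pairs V (labels q)" unfolding q by simp
    moreover have "labels q = (\<lambda>w. if w \<in> insert v Y then level P B (Suc k) w else level P B k w)"
      using I by (auto simp: q fun_eq_iff)
    moreover have "active q = {w \<in> insert v Y. front B (Suc k) w \<noteq> {}}" using I by (auto simp: q)
    moreover have "\<forall>w\<in>insert v Y. delta q w = front B (Suc k) w" using I by (auto simp: q)
    moreover have "flags q = flagged B (Suc k)" "msgs q = sent B k" using I by (auto simp: q)
    ultimately show "?I (insert v Y) q" by blast
  qed
  \<comment> \<open>A vertex without messages has no new entries, so its label is already that of
    the next level.\<close>
  have X: "v \<in> ?X" if "front B (Suc k) v \<noteq> {}" for v using that front_subset_sent by blast
  have "labels t = level P B (Suc k)"
    using I X by (auto simp: fun_eq_iff level_Suc)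
  moreover have "active t = {v. front B (Suc k) v \<noteq> {}}" using I X by blast
  ultimately show ?thesis using I unfolding bvc_inv_def by (metis (no_types, lifting) X mem_Collect_eq)
qed

text \<open>Between batches the labels are \<open>level P {} 0\<close>, the canonical entries with
  hub in \<open>P\<close> at any distance.\<close>

lemma bvc_batch_labels:
  assumes "parcs G = E" "bvc_batch G \<pi> T i s t" "batch G \<pi> T i = B"
    and "labels s = level P {} 0" "flags s = (\<lambda>_. {})" "cost s \<le> ordered_pairs V (labels s)"
  shows "labels t = level (P \<union> B) {} 0" "flags t = (\<lambda>_. {})" "cost t \<le> ordered_pairs V (labels t)"
proof -
  let ?s = "bvc_start B s"
  obtain r where r: "while_loop (\<lambda>s. active s \<noteq> {}) (bvc_iteration G \<pi>) ?s r" "t = r\<lparr>flags := (\<lambda>_. {})\<rparr>"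
    using assms(2,3) unfolding bvc_batch_def by auto
  have "bvc_inv 0 ?s"
  proof -
    have L: "labels ?s = level P B 0"
      using assms(4) B_subset by (auto simp: bvc_start_def level_def hub_0 fun_eq_iff)
    \<comment> \<open>The entries \<open>(u, 0)\<close> of the batch enter without a check, so the
      cost stays and the bound can only grow.\<close>
    moreover have "ordered_pairs V (labels s) \<le> ordered_pairs V (labels ?s)"
      unfolding L assms(4) by (rule ordered_pairs_mono[OF _ finite_level]) (auto simp: level_def)
    ultimately show ?thesis using assms(5,6) B_subset
      by (auto simp: bvc_inv_def bvc_start_def front_def hub_0 flagged_def fun_eq_iff)
  qed
  then have "(\<exists>k. bvc_inv k ?s)" ..
  then have "(\<exists>k. bvc_inv k r) \<and> \<not> active r \<noteq> {}"
    by (rule while_loop_invariant[OF r(1)]) (use bvc_iteration_inv[OF assms(1)] in blast)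
  then obtain k where k: "bvc_inv k r" "active r = {}" by blast
  \<comment> \<open>By \<open>hub_pred\<close>, an entry at a larger distance would require one at
    distance \<open>k\<close>, and the empty front has none. Hence the batch is complete.\<close>
  have far: "\<not> hub u (k + l) v" if "u \<in> B" for u v l
  proof (induction l arbitrary: v)
    case 0
    then show ?case using k that by (auto simp: bvc_inv_def front_def)
  next
    case (Suc l)
    then show ?case by (auto elim: hub_pred)
  qed
  have "hub u n v \<Longrightarrow> u \<in> B \<Longrightarrow> n \<le> k" for u n v
    using far[of u "n - k" v] by (cases "n \<le> k") auto
  then have "level P B k = level (P \<union> B) {} 0" by (auto simp: level_def fun_eq_iff)
  then show "labels t = level (P \<union> B) {} 0" "flags t = (\<lambda>_. {})" "cost t \<le> ordered_pairs V (labels t)"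
    using k r(2) unfolding bvc_inv_def by auto
qed

end

section \<open>Complete BVC-PLL runs and the upper bound\<close>

context ranked_graph
begin

lemma bvc_cost_le:
  assumes "parcs G = E" "pverts G = V" "\<And>v. v \<in> V \<Longrightarrow> 1 \<le> \<pi> v" "bvc_run G \<pi> T s"
  shows "cost s \<le> ordered_pairs V (\<lambda>v. {(u, n). hub u n v})"
proof -
  \<comment> \<open>\<open>?P i\<close> is the union of the batches before batch
    \<open>i\<close>.\<close>
  let ?P = "\<lambda>i. {u \<in> V. \<pi> u \<le> (i - 1) * card V div T}"
  let ?I = "\<lambda>i s::'a bvc_state. labels s = level (?P i) {} 0 \<and> flags s = (\<lambda>_. {}) \<and>
    cost s \<le> ordered_pairs V (labels s)"
  have "for_list (bvc_batch G \<pi> T) (map (\<lambda>i. i) [1..<T + 1]) bvc_init s"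
    using assms(4) unfolding bvc_run_def by simp
  then have "?I (T + 1) s"
  proof (rule for_list_upt_invariant)
    \<comment> \<open>Ranks start at 1, so \<open>?P 1\<close> is empty, as are the initial
      labels.\<close>
    show "?I 1 bvc_init"
      using assms(3) hub_in_V by (fastforce simp: bvc_init_def level_def fun_eq_iff)
  next
    fix i s t assume i: "1 \<le> i" and I: "?I i s" and b: "bvc_batch G \<pi> T i s t"
    let ?B = "batch G \<pi> T i"
    have le: "(i - 1) * card V div T \<le> i * card V div T" by (intro div_le_mono mult_le_mono1) simp
    interpret bvc_batch_context V E \<pi> "?P i" ?B
      by standard (auto simp: batch_def assms(2))
    have P: "?P (Suc i) = ?P i \<union> ?B" using le by (auto simp: batch_def assms(2))
    have s: "labels s = level (?P i) {} 0" "flags s = (\<lambda>_. {})" "cost s \<le> ordered_pairs V (labels s)"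
      using I by blast+
    show "?I (Suc i) t" unfolding P using bvc_batch_labels[OF assms(1) b refl s] by blast
  qed simp
  then have L: "labels s = level (?P (T + 1)) {} 0" and cost: "cost s \<le> ordered_pairs V (labels s)"
    by blast+
  have "ordered_pairs V (labels s) \<le> ordered_pairs V (\<lambda>v. {(u, n). hub u n v})"
    unfolding L by (intro ordered_pairs_mono finite_hubs) (auto simp: level_def)
  with cost show ?thesis by (rule order_trans)
qed

end

section \<open>Comparison of the two costs through the canonical labels\<close>

theorem theorem3:
  fixes G :: "'a pair_pre_digraph" and \<pi> :: "'a \<Rightarrow> nat" and T :: nat
    and s\<^sub>P :: "'a pll_state" and s\<^sub>B :: "'a bvc_state"
  assumes "pair_pseudo_graph G"
    and "bij_betw \<pi> (pverts G) {1..card (pverts G)}"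
    and "T dvd card (pverts G)"
    and "pll_run G \<pi> s\<^sub>P"
    and "bvc_run G \<pi> T s\<^sub>B"
  shows "cost s\<^sub>B \<le> cost s\<^sub>P"
proof -
  interpret pair_pseudo_graph G by fact
  interpret ranked_graph "pverts G" "parcs G" \<pi>
  proof
    show "parcs G \<subseteq> pverts G \<times> pverts G" using in_arcsD1 in_arcsD2 by auto
    show "sym (parcs G)" using arcs_symmetric by (auto intro: symI)
    show "inj_on \<pi> (pverts G)" using assms(2) by (rule bij_betw_imp_inj_on)
  qed (rule pair_finite_verts)
  have "cost s\<^sub>B \<le> ordered_pairs (pverts G) (\<lambda>v. {(u, n). hub u n v})"
    using bij_betwE[OF assms(2)] by (intro bvc_cost_le[OF refl refl _ assms(5)]) auto
  also have "\<dots> \<le> cost s\<^sub>P" by (rule pll_cost_ge[OF refl refl assms(2,4)])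
  finally show ?thesis .
qed

end
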